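(* Suppose that $A\in\mathbb{R}^{n\times n}$ has only real eigenvalues and that $\exp(At)$ is sign-symmetric for all $t\ge 0$. Then $A$ is an EP-matrix.
   Context: A matrix in $\mathbb{R}^{n\times n}$ is called a P-matrix if all its principal minors are positive. A matrix $A\in\mathbb{R}^{n\times n}$ is called an EP-matrix (exponential P-matrix) if $\exp(At)$ is a P-matrix for all $t\ge 0$. A matrix $M\in\mathbb{R}^{n\times n}$ is called sign-symmetric if for any $k\in\{1,\dots,n\}$ and any $\alpha,\beta\in Q^{k,n}$ we have $M(\alpha|\beta)M(\beta|\alpha)\ge 0$, where $Q^{k,n}$ is the set of increasing sequences of $k$ numbers from $\{1,\dots,n\}$ and $M(\alpha|\beta)$ is the minor of $M$ with row indices $\alpha$ and column indices $\beta$. *)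

theory Defs
  imports Jordan_Normal_Form.Char_Poly Jordan_Normal_Form.DL_Submatrix
begin

text \<open>Matrix indices start at 0, so sequences of indices are taken from \<open>{0, \<dots>, n - 1}\<close>.\<close>

definition incr_seqs :: "nat \<Rightarrow> nat \<Rightarrow> nat list set" where
  "incr_seqs k n = {\<alpha>. length \<alpha> = k \<and> sorted_wrt (<) \<alpha> \<and> set \<alpha> \<subseteq> {..<n}}"

text \<open>\<^const>\<open>submatrix\<close> keeps the selected rows and columns in increasing order, so for increasing
  sequences the underlying sets of indices suffice.\<close>

definition minor :: "'a :: comm_ring_1 mat \<Rightarrow> nat list \<Rightarrow> nat list \<Rightarrow> 'a" where
  "minor M \<alpha> \<beta> = det (submatrix M (set \<alpha>) (set \<beta>))"

definition P_matrix :: "nat \<Rightarrow> real mat \<Rightarrow> bool" where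
  "P_matrix n M \<longleftrightarrow> M \<in> carrier_mat n n \<and> (\<forall>k\<in>{1..n}. \<forall>\<alpha>\<in>incr_seqs k n. minor M \<alpha> \<alpha> > 0)"

definition sign_symmetric :: "nat \<Rightarrow> real mat \<Rightarrow> bool" where
  "sign_symmetric n M \<longleftrightarrow> M \<in> carrier_mat n n \<and>
     (\<forall>k\<in>{1..n}. \<forall>\<alpha>\<in>incr_seqs k n. \<forall>\<beta>\<in>incr_seqs k n. minor M \<alpha> \<beta> * minor M \<beta> \<alpha> \<ge> 0)"

text \<open>The exponential series, summed entry by entry; it converges by \<open>summable_mat_exp\<close> below.\<close>

definition mat_exp :: "real mat \<Rightarrow> real mat" where
  "mat_exp A = mat (dim_row A) (dim_col A) (\<lambda>(i, j). \<Sum>k. (A ^\<^sub>m k) $$ (i, j) / fact k)"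

lemma summable_mat_exp:
  assumes A: "A \<in> carrier_mat n n" and i: "i < n" and j: "j < n"
  shows "summable (\<lambda>k. (A ^\<^sub>m k) $$ (i, j) / fact k :: real)"
proof -
  define c where "c = (\<Sum>p<n. \<Sum>q<n. \<bar>A $$ (p, q)\<bar>)"
  have pow: "A ^\<^sub>m k \<in> carrier_mat n n" for k
    using A by simp
  have c: "\<bar>A $$ (p, q)\<bar> \<le> c" if "p < n" "q < n" for p q
  proof -
    have "\<bar>A $$ (p, q)\<bar> \<le> (\<Sum>q<n. \<bar>A $$ (p, q)\<bar>)"
      using that by (intro member_le_sum) auto
    also have "\<dots> \<le> c"
      unfolding c_def using that
      by (intro member_le_sum[where f = "\<lambda>p. \<Sum>q<n. \<bar>A $$ (p, q)\<bar>"]) (auto intro: sum_nonneg)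
    finally show ?thesis .
  qed
  have bound: "\<bar>(A ^\<^sub>m k) $$ (i, q)\<bar> \<le> (real n * c) ^ k" if "q < n" for k q
    using that
  proof (induction k arbitrary: q)
    case 0
    then show ?case using A i by simp
  next
    case (Suc k)
    have c0: "0 \<le> c" unfolding c_def by (intro sum_nonneg) auto
    have "(A ^\<^sub>m Suc k) $$ (i, q) = (\<Sum>p<n. (A ^\<^sub>m k) $$ (i, p) * A $$ (p, q))"
      using A pow[of k] i Suc.prems
      by (simp add: scalar_prod_def lessThan_atLeast0)
    also have "\<bar>\<dots>\<bar> \<le> (\<Sum>p<n. (real n * c) ^ k * c)"
      using Suc.IH Suc.prems c c0
      by (intro order.trans[OF sum_abs] sum_mono) (auto simp: abs_mult intro!: mult_mono)
    also have "\<dots> = (real n * c) ^ Suc k" by simp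
    finally show ?case .
  qed
  have "summable (\<lambda>k. (real n * c) ^ k / fact k)"
    using summable_exp[of "real n * c"] by (simp add: field_simps)
  then show ?thesis
    by (rule summable_comparison_test'[where N = 0])
       (use bound j in \<open>auto simp: divide_right_mono\<close>)
qed

definition EP_matrix :: "nat \<Rightarrow> real mat \<Rightarrow> bool" where
  "EP_matrix n A \<longleftrightarrow> A \<in> carrier_mat n n \<and> (\<forall>t\<ge>0. P_matrix n (mat_exp (t \<cdot>\<^sub>m A)))"

text \<open>Eigenvalues of a real matrix are meant in the complex plane.\<close>

definition only_real_eigenvalues :: "real mat \<Rightarrow> bool" where
  "only_real_eigenvalues A \<longleftrightarrow> (\<forall>z. eigenvalue (map_mat complex_of_real A) z \<longrightarrow> z \<in> \<real>)"

end

theory Submission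
  imports Defs
begin

text \<open>For \<open>M = exp(tA/2)\<close> the Cauchy--Binet formula writes the principal minor of \<open>exp(tA) = M\<^sup>2\<close>
  at \<open>\<alpha>\<close> as \<open>\<Sum>\<beta>. M(\<alpha>|\<beta>) M(\<beta>|\<alpha>)\<close>. By sign-symmetry all terms are nonnegative, so the minor is
  at least the term \<open>M(\<alpha>|\<alpha>)\<^sup>2\<close>. Hence positivity of a principal minor passes from \<open>t/2\<close> to \<open>t\<close>,
  and it holds at \<open>t/2\<^sup>m\<close> for large \<open>m\<close> because \<open>exp(sA)\<close> tends to the identity as \<open>s\<close> tends to 0.\<close>

section \<open>Increasing enumeration of index sets, and submatrices\<close>

text \<open>\<open>pick J\<close> is strictly increasing below \<open>card J\<close>, hence
  injective there, and its values lie in \<open>J\<close>; counting elements then gives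
  surjectivity.\<close>

lemma bij_betw_pick:
  assumes "finite J"
  shows "bij_betw (pick J) {0..<card J} J"
proof -
  have inj: "inj_on (pick J) {0..<card J}"
  proof (rule linorder_inj_onI')
    fix i j assume "i \<in> {0..<card J}" "j \<in> {0..<card J}" "i < j"
    then have "pick J i < pick J j" by (intro pick_mono_le) auto
    then show "pick J i \<noteq> pick J j" by simp
  qed
  moreover have "pick J ` {0..<card J} \<subseteq> J"
    using pick_in_set_le by auto
  ultimately show ?thesis
    using card_subset_eq[OF assms, of "pick J ` {0..<card J}"] by (simp add: bij_betw_def card_image)
qed

lemma pick_lessThan:
  assumes "i < k"
  shows "pick {..<k} i = i"
proof -
  have "{a. a < k \<and> a \<in> UNIV} = {..<k}" by auto
  then show ?thesis using pick_reduce_set[of i k UNIV] assms by (simp add: pick_UNIV)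
qed

text \<open>\<open>submatrix\<close> ignores indices beyond the dimensions of the matrix. The
  inclusions for \<open>I\<close> and \<open>J\<close> ensure that nothing is ignored, so the
  dimensions are plain cardinalities.\<close>

lemma submatrix_carrier:
  assumes "M \<in> carrier_mat m n" "I \<subseteq> {..<m}" "J \<subseteq> {..<n}"
  shows "submatrix M I J \<in> carrier_mat (card I) (card J)"
proof -
  have "{i. i < m \<and> i \<in> I} = I" "{j. j < n \<and> j \<in> J} = J" using assms by auto
  then show ?thesis using assms(1) by (intro carrier_matI) (simp_all add: dim_submatrix)
qed

lemma index_submatrix:
  assumes "M \<in> carrier_mat m n" "I \<subseteq> {..<m}" "J \<subseteq> {..<n}" "i < card I" "j < card J"
  shows "submatrix M I J $$ (i, j) = M $$ (pick I i, pick J j)"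
proof -
  have "{i. i < m \<and> i \<in> I} = I" "{j. j < n \<and> j \<in> J} = J" using assms by auto
  then show ?thesis using assms by (simp add: submatrix_index)
qed

section \<open>The Cauchy--Binet formula\<close>

text \<open>Each row of \<open>C * D\<close> is a linear combination of rows of \<open>D\<close>, so
  multilinearity expands the determinant into a sum over all maps \<open>f\<close> that choose a row
  of \<open>D\<close> for each row of \<open>C\<close>. Only injective maps contribute; those with
  image \<open>J\<close> are the permutations of \<open>J\<close>, and their sum is a Leibniz
  formula.\<close>

lemma Cauchy_Binet:
  fixes C D :: "'a :: comm_ring_1 mat"
  assumes C: "C \<in> carrier_mat k n" and D: "D \<in> carrier_mat n k"
  shows "det (C * D) =
    (\<Sum>J | J \<subseteq> {..<n} \<and> card J = k. det (submatrix C {..<k} J) * det (submatrix D J {..<k}))"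
proof -
  let ?K = "{0..<k}"
  \<comment> \<open>Requiring \<open>f i = i\<close> outside \<open>?K\<close> makes each choice of
    rows correspond to exactly one function.\<close>
  define F where "F = {f. (\<forall>i\<in>?K. f i \<in> {0..<n}) \<and> (\<forall>i. i \<notin> ?K \<longrightarrow> f i = i)}"
  define h where "h f = (\<Prod>i = 0..<k. C $$ (i, f i)) * det (mat k k (\<lambda>(i, j). D $$ (f i, j)))" for f
  have finF: "finite F" unfolding F_def by (rule finite_bounded_functions) auto
  have "det (C * D) = (\<Sum>f\<in>F. det (mat\<^sub>r k k (\<lambda>i. C $$ (i, f i) \<cdot>\<^sub>v row D (f i))))"
    unfolding mat_mul_finsum_alt[OF C D] F_def
    by (rule det_linear_rows_sum) (use D in auto)
  also have "\<dots> = (\<Sum>f\<in>F. h f)"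
  proof (rule sum.cong)
    fix f assume f: "f \<in> F"
    have "det (mat\<^sub>r k k (\<lambda>i. C $$ (i, f i) \<cdot>\<^sub>v row D (f i)))
        = (\<Prod>i = 0..<k. C $$ (i, f i)) * det (mat\<^sub>r k k (\<lambda>i. row D (f i)))"
      by (rule det_rows_mul) (use D in auto)
    also have "mat\<^sub>r k k (\<lambda>i. row D (f i)) = mat k k (\<lambda>(i, j). D $$ (f i, j))"
      by (rule eq_matI) (use D f in \<open>auto simp: F_def\<close>)
    finally show "det (mat\<^sub>r k k (\<lambda>i. C $$ (i, f i) \<cdot>\<^sub>v row D (f i))) = h f"
      by (simp add: h_def)
  qed simp
  \<comment> \<open>The maps are grouped by their image, which will become the index set of the
    minors.\<close>
  also have "\<dots> = (\<Sum>J\<in>Pow {..<n}. \<Sum>f | f \<in> F \<and> f ` ?K = J. h f)"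
    by (rule sum.group[symmetric]) (auto simp: finF, auto simp: F_def)
  also have "\<dots> = (\<Sum>J | J \<subseteq> {..<n} \<and> card J = k. \<Sum>f | f \<in> F \<and> f ` ?K = J. h f)"
  proof (rule sum.mono_neutral_right)
    show "\<forall>J\<in>Pow {..<n} - {J. J \<subseteq> {..<n} \<and> card J = k}. (\<Sum>f | f \<in> F \<and> f ` ?K = J. h f) = 0"
    proof (intro ballI sum.neutral)
      fix J f
      assume J: "J \<in> Pow {..<n} - {J. J \<subseteq> {..<n} \<and> card J = k}"
        and f: "f \<in> {f. f \<in> F \<and> f ` ?K = J}"
      \<comment> \<open>An image of the wrong size forces a row of \<open>D\<close> to be chosen
        twice, and a determinant with two equal rows vanishes.\<close>
      have "\<not> inj_on f ?K" using J f card_image[of f ?K] by auto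
      then obtain i j where ij: "i < k" "j < k" "i \<noteq> j" "f i = f j"
        by (auto simp: inj_on_def)
      have "det (mat k k (\<lambda>(i, j). D $$ (f i, j))) = 0"
        by (rule det_identical_rows[of _ k i j]) (use ij in auto)
      then show "h f = 0" by (simp add: h_def)
    qed
  qed auto
  also have "\<dots> = (\<Sum>J | J \<subseteq> {..<n} \<and> card J = k.
      det (submatrix C {..<k} J) * det (submatrix D J {..<k}))"
  proof (rule sum.cong)
    fix J assume "J \<in> {J. J \<subseteq> {..<n} \<and> card J = k}"
    then have J: "J \<subseteq> {..<n}" and cardJ: "card J = k" by auto
    have pick: "bij_betw (pick J) ?K J"
      using bij_betw_pick[of J] cardJ J finite_subset by blast
    let ?g = "\<lambda>p i. if i < k then pick J (p i) else i"
    let ?C = "submatrix C {..<k} J" and ?D = "submatrix D J {..<k}"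
    have C': "?C \<in> carrier_mat k k" using submatrix_carrier[OF C _ J, of "{..<k}"] cardJ by simp
    have D': "?D \<in> carrier_mat k k" using submatrix_carrier[OF D J, of "{..<k}"] cardJ by simp
    have bij: "bij_betw ?g {p. p permutes ?K} {f. f \<in> F \<and> f ` ?K = J}"
    \<comment> \<open>The inverse pulls \<open>f\<close> back along the enumeration
      \<open>pick J\<close>. The value \<open>i\<close> for \<open>i \<ge> k\<close> is what both
      \<open>permutes\<close> and \<open>F\<close> demand, so the two maps are inverse to each other
      on total functions.\<close>
    proof (rule bij_betwI[where g = "\<lambda>f i. if i < k then inv_into ?K (pick J) (f i) else i"])
      show "?g \<in> {p. p permutes ?K} \<rightarrow> {f. f \<in> F \<and> f ` ?K = J}"
      proof
        fix p assume "p \<in> {p. p permutes ?K}"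
        then have p: "p permutes ?K" by simp
        have "?g p ` ?K = pick J ` p ` ?K" by (auto simp: image_iff)
        then have im: "?g p ` ?K = J"
          using pick by (simp only: permutes_image[OF p] bij_betw_def)
        then show "?g p \<in> {f. f \<in> F \<and> f ` ?K = J}"
          using J by (fastforce simp: F_def)
      qed
      show "(\<lambda>f i. if i < k then inv_into ?K (pick J) (f i) else i)
          \<in> {f. f \<in> F \<and> f ` ?K = J} \<rightarrow> {p. p permutes ?K}"
      proof
        fix f assume f: "f \<in> {f. f \<in> F \<and> f ` ?K = J}"
        then have im: "f ` ?K = J" by simp
        have "inj_on f ?K" using im cardJ by (intro eq_card_imp_inj_on) auto
        then have "bij_betw (inv_into ?K (pick J) \<circ> f) ?K ?K"
          using im by (intro bij_betw_trans[of f ?K J] bij_betw_inv_into pick) (simp add: bij_betw_def)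
        then have "bij_betw (\<lambda>i. if i < k then inv_into ?K (pick J) (f i) else i) ?K ?K"
          by (subst bij_betw_cong[where g = "inv_into ?K (pick J) \<circ> f"]) auto
        then show "(\<lambda>i. if i < k then inv_into ?K (pick J) (f i) else i) \<in> {p. p permutes ?K}"
          by (auto intro: bij_imp_permutes)
      qed
    next
      fix p assume "p \<in> {p. p permutes ?K}"
      then have p: "p permutes ?K" by simp
      show "(\<lambda>i. if i < k then inv_into ?K (pick J) (?g p i) else i) = p"
      proof
        fix i
        have "p i \<in> ?K" if "i < k" using permutes_in_image[OF p, of i] that by simp
        then show "(if i < k then inv_into ?K (pick J) (?g p i) else i) = p i"
          using pick permutes_not_in[OF p, of i] by (auto simp: bij_betw_def inv_into_f_f)
      qed
    next
      fix f assume f: "f \<in> {f. f \<in> F \<and> f ` ?K = J}"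
      show "?g (\<lambda>i. if i < k then inv_into ?K (pick J) (f i) else i) = f"
      proof
        fix i
        have "pick J (inv_into ?K (pick J) (f i)) = f i" if "i < k"
          using pick f that by (intro f_inv_into_f) (auto simp: bij_betw_def)
        then show "?g (\<lambda>i. if i < k then inv_into ?K (pick J) (f i) else i) i = f i"
          using f by (auto simp: F_def)
      qed
    qed
    have hg: "h (?g p) = signof p * (\<Prod>i = 0..<k. ?C $$ (i, p i)) * det ?D" if p: "p permutes ?K" for p
    proof -
      have pk: "p i < k" if "i < k" for i using permutes_in_image[OF p, of i] that by simp
      \<comment> \<open>The chosen rows of \<open>D\<close> are the rows of \<open>?D\<close> in the
        order given by \<open>p\<close>. Reordering them produces the sign that the Leibniz formula
        for \<open>det ?C\<close> needs.\<close>
      have "mat k k (\<lambda>(i, j). D $$ (?g p i, j)) = mat k k (\<lambda>(i, j). ?D $$ (p i, j))"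
        using pk cardJ by (intro eq_matI) (auto simp: index_submatrix[OF D J] pick_lessThan)
      then have "det (mat k k (\<lambda>(i, j). D $$ (?g p i, j))) = signof p * det ?D"
        using det_permute_rows[OF D' p] by simp
      moreover have "(\<Prod>i = 0..<k. C $$ (i, ?g p i)) = (\<Prod>i = 0..<k. ?C $$ (i, p i))"
        using pk cardJ by (intro prod.cong) (auto simp: index_submatrix[OF C _ J] pick_lessThan)
      ultimately show ?thesis by (simp add: h_def mult_ac)
    qed
    have "(\<Sum>f | f \<in> F \<and> f ` ?K = J. h f) = (\<Sum>p | p permutes ?K. h (?g p))"
      by (rule sum.reindex_bij_betw[OF bij, symmetric])
    also have "\<dots> = det ?C * det ?D"
      by (simp add: hg det_def'[OF C'] sum_distrib_right)
    finally show "(\<Sum>f | f \<in> F \<and> f ` ?K = J. h f) = det ?C * det ?D" .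
  qed simp
  finally show ?thesis .
qed

text \<open>Only the rows \<open>I\<close> of \<open>A\<close> and the columns \<open>K\<close> of
  \<open>B\<close> enter the minor, so \<open>Cauchy_Binet\<close> applies to the product of these
  two rectangular blocks. Selecting \<open>J\<close> inside the blocks then gives submatrices of
  \<open>A\<close> and \<open>B\<close> themselves.\<close>

lemma Cauchy_Binet_minor:
  fixes A B :: "'a :: comm_ring_1 mat"
  assumes A: "A \<in> carrier_mat m n" and B: "B \<in> carrier_mat n l"
    and I: "I \<subseteq> {..<m}" "card I = k" and K: "K \<subseteq> {..<l}" "card K = k"
  shows "det (submatrix (A * B) I K) =
    (\<Sum>J | J \<subseteq> {..<n} \<and> card J = k. det (submatrix A I J) * det (submatrix B J K))"
proof -
  let ?A = "submatrix A I {..<n}" and ?B = "submatrix B {..<n} K"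
  have A': "?A \<in> carrier_mat k n" using submatrix_carrier[OF A I(1), of "{..<n}"] I by simp
  have B': "?B \<in> carrier_mat n k" using submatrix_carrier[OF B _ K(1), of "{..<n}"] K by simp
  have pickI: "pick I i < m" if "i < k" for i using that I pick_in_set_le by auto
  have pickK: "pick K i < l" if "i < k" for i using that K pick_in_set_le by auto
  have AB: "A * B \<in> carrier_mat m l" using A B by simp
  have S: "submatrix (A * B) I K \<in> carrier_mat k k" using submatrix_carrier[OF AB I(1) K(1)] I K by simp
  have "submatrix (A * B) I K = ?A * ?B"
  proof (rule eq_matI)
    fix i j assume "i < dim_row (?A * ?B)" "j < dim_col (?A * ?B)"
    then have ij: "i < k" "j < k" using A' B' by auto
    then show "submatrix (A * B) I K $$ (i, j) = (?A * ?B) $$ (i, j)"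
      using A B A' B' I K pickI[of i] pickK[of j]
      by (auto simp: index_submatrix[OF AB] scalar_prod_def index_submatrix[OF A I(1)]
          index_submatrix[OF B _ K(1)] pick_lessThan intro!: sum.cong)
  qed (use S A' B' in auto)
  then have "det (submatrix (A * B) I K) = (\<Sum>J | J \<subseteq> {..<n} \<and> card J = k.
      det (submatrix ?A {..<k} J) * det (submatrix ?B J {..<k}))"
    by (simp add: Cauchy_Binet[OF A' B'])
  also have "\<dots> = (\<Sum>J | J \<subseteq> {..<n} \<and> card J = k. det (submatrix A I J) * det (submatrix B J K))"
  proof (rule sum.cong)
    fix J assume "J \<in> {J. J \<subseteq> {..<n} \<and> card J = k}"
    then have J: "J \<subseteq> {..<n}" "card J = k" by auto
    have pickJ: "pick J i < n" if "i < k" for i using that J pick_in_set_le by auto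
    have "submatrix ?A {..<k} J = submatrix A I J"
      using I J submatrix_carrier[OF A I(1) J(1)] submatrix_carrier[OF A' _ J(1), of "{..<k}"] pickJ
      by (intro eq_matI) (auto simp: index_submatrix[OF A] index_submatrix[OF A'] pick_lessThan)
    moreover have "submatrix ?B J {..<k} = submatrix B J K"
      using K J submatrix_carrier[OF B J(1) K(1)] submatrix_carrier[OF B' J(1), of "{..<k}"] pickJ
      by (intro eq_matI) (auto simp: index_submatrix[OF B] index_submatrix[OF B'] pick_lessThan)
    ultimately show "det (submatrix ?A {..<k} J) * det (submatrix ?B J {..<k})
        = det (submatrix A I J) * det (submatrix B J K)" by simp
  qed simp
  finally show ?thesis .
qed

section \<open>Matrix powers and the exponential series\<close>

lemma smult_smult_mat: "a \<cdot>\<^sub>m (b \<cdot>\<^sub>m A) = (a * b) \<cdot>\<^sub>m (A :: 'a :: semigroup_mult mat)"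
  by (rule eq_matI) (auto simp: mult.assoc)

lemma pow_smult_mat:
  fixes A :: "'a :: comm_ring_1 mat"
  assumes "A \<in> carrier_mat n n"
  shows "(c \<cdot>\<^sub>m A) ^\<^sub>m k = c ^ k \<cdot>\<^sub>m A ^\<^sub>m k"
proof (induction k)
  case 0
  show ?case using assms by (auto intro!: eq_matI)
next
  case (Suc k)
  have "A ^\<^sub>m k \<in> carrier_mat n n" using assms by simp
  then show ?case using Suc assms
    by (auto simp: mult_smult_distrib[of _ n n _ n] mult_smult_assoc_mat[of _ n n _ n] smult_smult_mat)
qed

lemma pow_add_mat:
  fixes A :: "'a :: semiring_1 mat"
  assumes "A \<in> carrier_mat n n"
  shows "A ^\<^sub>m (a + b) = A ^\<^sub>m a * A ^\<^sub>m b"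
proof (induction b)
  case (Suc b)
  then show ?case using assms pow_carrier_mat[OF assms]
    by (simp add: assoc_mult_mat[of _ n n _ n _ n])
qed (use assms in simp)

lemma mat_exp_carrier [simp]: "A \<in> carrier_mat n n \<Longrightarrow> mat_exp A \<in> carrier_mat n n"
  by (simp add: mat_exp_def)

lemma index_mat_exp_smult:
  assumes "A \<in> carrier_mat n n" "i < n" "j < n"
  shows "mat_exp (t \<cdot>\<^sub>m A) $$ (i, j) = (\<Sum>k. (A ^\<^sub>m k) $$ (i, j) / fact k * t ^ k)"
proof -
  have "((t \<cdot>\<^sub>m A) ^\<^sub>m k) $$ (i, j) = (A ^\<^sub>m k) $$ (i, j) * t ^ k" for k
    using assms by (simp add: pow_smult_mat[OF assms(1)])
  then show ?thesis
    using assms by (simp add: mat_exp_def)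
qed

lemma summable_mat_exp_powser:
  fixes A :: "real mat"
  assumes "A \<in> carrier_mat n n" "i < n" "j < n"
  shows "summable (\<lambda>k. (A ^\<^sub>m k) $$ (i, j) / fact k * t ^ k)"
  using summable_mat_exp[of "t \<cdot>\<^sub>m A" n i j] assms
  by (simp add: pow_smult_mat[OF assms(1)] mult.commute)

text \<open>The entry is a power series in \<open>t\<close> evaluated at 1. It converges at 2, and a
  power series converges absolutely strictly inside its disc of convergence.\<close>

lemma summable_norm_mat_exp:
  fixes A :: "real mat"
  assumes "A \<in> carrier_mat n n" "i < n" "j < n"
  shows "summable (\<lambda>k. norm ((A ^\<^sub>m k) $$ (i, j) / fact k))"
  using powser_insidea[OF summable_mat_exp_powser[OF assms, of 2], of 1] by simp

text \<open>Multiplying the exponential series entry by entry as Cauchy products produces binomial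
  coefficients, whose row sums \<open>2 ^ k\<close> are the factors by which doubling the argument
  scales the terms.\<close>

lemma mat_exp_double:
  assumes A: "A \<in> carrier_mat n n"
  shows "mat_exp (2 \<cdot>\<^sub>m A) = mat_exp A * mat_exp A"
proof (rule eq_matI)
  fix i j assume "i < dim_row (mat_exp A * mat_exp A)" "j < dim_col (mat_exp A * mat_exp A)"
  then have ij: "i < n" "j < n" using mat_exp_carrier[OF A] by auto
  let ?e = "\<lambda>i j k. (A ^\<^sub>m k) $$ (i, j) / fact k"
  have prod: "(\<lambda>k. \<Sum>a\<le>k. ?e i p a * ?e p j (k - a)) sums (mat_exp A $$ (i, p) * mat_exp A $$ (p, j))"
    if "p < n" for p
    using Cauchy_product_sums[OF summable_norm_mat_exp[OF A ij(1) that] summable_norm_mat_exp[OF A that ij(2)]]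
      A ij that by (simp add: mat_exp_def)
  \<comment> \<open>Summing over \<open>p\<close> first turns the entries into those of
    \<open>A ^\<^sub>m a * A ^\<^sub>m (k - a)\<close>, which is \<open>A ^\<^sub>m k\<close> for
    every \<open>a\<close>; only the factorials still depend on \<open>a\<close>.\<close>
  have coeff: "(\<Sum>p = 0..<n. \<Sum>a\<le>k. ?e i p a * ?e p j (k - a)) = ?e i j k * 2 ^ k" for k
  proof -
    have "(\<Sum>p = 0..<n. \<Sum>a\<le>k. ?e i p a * ?e p j (k - a))
        = (\<Sum>a\<le>k. (\<Sum>p = 0..<n. (A ^\<^sub>m a) $$ (i, p) * (A ^\<^sub>m (k - a)) $$ (p, j)) / (fact a * fact (k - a)))"
      by (subst sum.swap) (simp add: sum_divide_distrib)
    also have "\<dots> = (\<Sum>a\<le>k. ?e i j k * of_nat (k choose a))"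
    proof (rule sum.cong)
      fix a assume a: "a \<in> {..k}"
      have "(\<Sum>p = 0..<n. (A ^\<^sub>m a) $$ (i, p) * (A ^\<^sub>m (k - a)) $$ (p, j)) = (A ^\<^sub>m a * A ^\<^sub>m (k - a)) $$ (i, j)"
        using A ij by (simp add: scalar_prod_def)
      also have "A ^\<^sub>m a * A ^\<^sub>m (k - a) = A ^\<^sub>m k"
        using pow_add_mat[OF A, of a "k - a"] a by simp
      finally show "(\<Sum>p = 0..<n. (A ^\<^sub>m a) $$ (i, p) * (A ^\<^sub>m (k - a)) $$ (p, j)) / (fact a * fact (k - a))
          = ?e i j k * of_nat (k choose a)"
        using a by (simp add: binomial_fact)
    qed simp
    also have "\<dots> = ?e i j k * 2 ^ k"
      by (simp only: sum_distrib_left[symmetric] of_nat_sum[symmetric] choose_row_sum of_nat_power of_nat_numeral)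
    finally show ?thesis .
  qed
  have "(\<lambda>k. ?e i j k * 2 ^ k) sums (\<Sum>p = 0..<n. mat_exp A $$ (i, p) * mat_exp A $$ (p, j))"
    unfolding coeff[symmetric] by (intro sums_sum prod) simp
  then have "(\<Sum>k. ?e i j k * 2 ^ k) = (\<Sum>p = 0..<n. mat_exp A $$ (i, p) * mat_exp A $$ (p, j))"
    by (rule sums_unique[symmetric])
  also have "\<dots> = (mat_exp A * mat_exp A) $$ (i, j)"
    using ij mat_exp_carrier[OF A] by (auto simp: scalar_prod_def)
  finally show "mat_exp (2 \<cdot>\<^sub>m A) $$ (i, j) = (mat_exp A * mat_exp A) $$ (i, j)"
    by (simp add: index_mat_exp_smult[OF A ij])
qed (use A in \<open>auto simp: mat_exp_def\<close>)

section \<open>The exponential and its minors near 0\<close>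

text \<open>An everywhere convergent power series is continuous, and its value at 0 is the constant
  coefficient, an entry of \<open>A ^\<^sub>m 0\<close>. The filter \<open>nhds 0\<close> includes
  the point 0, so the limit can later be composed with a sequence that takes the value 0.\<close>

lemma tendsto_mat_exp_smult:
  assumes A: "A \<in> carrier_mat n n" and ij: "i < n" "j < n"
  shows "((\<lambda>t. mat_exp (t \<cdot>\<^sub>m A) $$ (i, j)) \<longlongrightarrow> 1\<^sub>m n $$ (i, j)) (nhds 0)"
proof -
  let ?c = "\<lambda>k. (A ^\<^sub>m k) $$ (i, j) / fact k"
  have "isCont (\<lambda>t. \<Sum>k. ?c k * t ^ k) 0"
    by (rule isCont_powser_converges_everywhere) (rule summable_mat_exp_powser[OF assms])
  then have "((\<lambda>t. \<Sum>k. ?c k * t ^ k) \<longlongrightarrow> (\<Sum>k. ?c k * 0 ^ k)) (nhds 0)"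
    unfolding isCont_def
    by (rule tendsto_at_iff_tendsto_nhds[where g = "\<lambda>t. \<Sum>k. ?c k * t ^ k", THEN iffD1])
  moreover have "(\<Sum>k. ?c k * 0 ^ k) = 1\<^sub>m n $$ (i, j)"
    unfolding powser_zero using A ij by simp
  ultimately show ?thesis
    by (simp only: index_mat_exp_smult[OF assms])
qed

text \<open>By the Leibniz formula a minor is a polynomial in the entries, so entrywise limits
  suffice. A principal submatrix of the identity is again an identity, because \<open>pick\<close>
  is injective.\<close>

lemma tendsto_minor_mat_exp:
  assumes A: "A \<in> carrier_mat n n" and \<alpha>: "set \<alpha> \<subseteq> {..<n}"
  shows "((\<lambda>t. minor (mat_exp (t \<cdot>\<^sub>m A)) \<alpha> \<alpha>) \<longlongrightarrow> 1) (nhds 0)"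
proof -
  define k where "k = card (set \<alpha>)"
  have carrier: "submatrix M (set \<alpha>) (set \<alpha>) \<in> carrier_mat k k" if "M \<in> carrier_mat n n" for M :: "real mat"
    using submatrix_carrier[OF that \<alpha> \<alpha>] by (simp add: k_def)
  have pick: "pick (set \<alpha>) i < n" if "i < k" for i
    using pick_in_set_le[of i "set \<alpha>"] that \<alpha> by (auto simp: k_def)
  have "submatrix (1\<^sub>m n) (set \<alpha>) (set \<alpha>) = (1\<^sub>m k :: real mat)"
    using carrier[of "1\<^sub>m n"] pick bij_betw_imp_inj_on[OF bij_betw_pick[of "set \<alpha>"]]
    by (intro eq_matI) (auto simp: index_submatrix[OF one_carrier_mat \<alpha> \<alpha>] k_def inj_on_eq_iff)
  then have one: "det (submatrix (1\<^sub>m n) (set \<alpha>) (set \<alpha>)) = (1 :: real)" by simp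
  have "((\<lambda>t. det (submatrix (mat_exp (t \<cdot>\<^sub>m A)) (set \<alpha>) (set \<alpha>)))
      \<longlongrightarrow> det (submatrix (1\<^sub>m n) (set \<alpha>) (set \<alpha>))) (nhds 0)"
    unfolding det_def'[OF carrier[OF mat_exp_carrier[OF smult_carrier_mat[OF A]]]]
      det_def'[OF carrier[OF one_carrier_mat]]
  proof (intro tendsto_sum tendsto_mult tendsto_const tendsto_prod)
    fix p i assume "p \<in> {p. p permutes {0..<k}}" "i \<in> {0..<k}"
    then have i: "i < k" "p i < k" using permutes_in_image[of p "{0..<k}" i] by auto
    then show "((\<lambda>t. submatrix (mat_exp (t \<cdot>\<^sub>m A)) (set \<alpha>) (set \<alpha>) $$ (i, p i))
        \<longlongrightarrow> submatrix (1\<^sub>m n) (set \<alpha>) (set \<alpha>) $$ (i, p i)) (nhds 0)"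
      using tendsto_mat_exp_smult[OF A pick[OF i(1)] pick[OF i(2)]]
      by (simp add: k_def index_submatrix[OF one_carrier_mat \<alpha> \<alpha>]
          index_submatrix[OF mat_exp_carrier[OF smult_carrier_mat[OF A]] \<alpha> \<alpha>])
  qed
  then show ?thesis by (simp add: minor_def one)
qed

section \<open>Sign-symmetry and positivity of principal minors\<close>

lemma minor_square_ge:
  assumes M: "sign_symmetric n M" and k: "k \<in> {1..n}" and \<alpha>: "\<alpha> \<in> incr_seqs k n"
  shows "minor (M * M) \<alpha> \<alpha> \<ge> (minor M \<alpha> \<alpha>)\<^sup>2"
proof -
  have carrier: "M \<in> carrier_mat n n" using M by (simp add: sign_symmetric_def)
  have set\<alpha>: "set \<alpha> \<subseteq> {..<n}" "card (set \<alpha>) = k"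
    using \<alpha> by (auto simp: incr_seqs_def strict_sorted_iff distinct_card)
  let ?J = "{J. J \<subseteq> {..<n} \<and> card J = k}"
  let ?s = "\<lambda>J. det (submatrix M (set \<alpha>) J) * det (submatrix M J (set \<alpha>))"
  have fin: "finite ?J" by (rule finite_subset[of _ "Pow {..<n}"]) auto
  have nonneg: "?s J \<ge> 0" if "J \<in> ?J" for J
  proof -
    \<comment> \<open>Cauchy--Binet sums over sets and sign-symmetry speaks of sequences; sorting
      \<open>J\<close> translates between them.\<close>
    have "finite J" using that finite_subset by blast
    then have "set (sorted_list_of_set J) = J" "sorted_list_of_set J \<in> incr_seqs k n"
      using that by (auto simp: incr_seqs_def)
    then show ?thesis
      using M k \<alpha> unfolding sign_symmetric_def minor_def by metis
  qed
  \<comment> \<open>The diagonal term \<open>J = set \<alpha>\<close> is the square of the principal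
    minor.\<close>
  have "?s (set \<alpha>) \<le> sum ?s ?J"
    by (rule member_le_sum) (use set\<alpha> fin nonneg in auto)
  then show ?thesis
    by (simp add: minor_def Cauchy_Binet_minor[OF carrier carrier set\<alpha> set\<alpha>] power2_eq_square)
qed

theorem proposition3:
  fixes n :: nat and A :: "real mat"
  assumes "A \<in> carrier_mat n n"
    and "only_real_eigenvalues A"
    and "\<And>t :: real. t \<ge> 0 \<Longrightarrow> sign_symmetric n (mat_exp (t \<cdot>\<^sub>m A))"
  shows "EP_matrix n A"
proof -
  have "minor (mat_exp (t \<cdot>\<^sub>m A)) \<alpha> \<alpha> > 0"
    if t: "t \<ge> 0" and k: "k \<in> {1..n}" and \<alpha>: "\<alpha> \<in> incr_seqs k n" for t k \<alpha>
  proof -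
    let ?f = "\<lambda>t. minor (mat_exp (t \<cdot>\<^sub>m A)) \<alpha> \<alpha>"
    have set\<alpha>: "set \<alpha> \<subseteq> {..<n}" using \<alpha> by (simp add: incr_seqs_def)
    have double: "?f (2 * s) > 0" if "s \<ge> 0" "?f s > 0" for s
    proof -
      have "mat_exp ((2 * s) \<cdot>\<^sub>m A) = mat_exp (s \<cdot>\<^sub>m A) * mat_exp (s \<cdot>\<^sub>m A)"
        using mat_exp_double[of "s \<cdot>\<^sub>m A" n] assms(1) by (simp only: smult_smult_mat smult_carrier_mat)
      then have "?f (2 * s) \<ge> (?f s)\<^sup>2"
        using minor_square_ge[OF assms(3)[OF that(1)] k \<alpha>] by (simp only:)
      moreover have "(?f s)\<^sup>2 > 0" using that(2) by (rule zero_less_power)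
      ultimately show ?thesis by linarith
    qed
    \<comment> \<open>Iterated doubling: \<open>s / 2 ^ Suc m\<close> equals
      \<open>(s / 2) / 2 ^ m\<close>, so the induction hypothesis is used at \<open>s / 2\<close>,
      followed by one doubling. This is why \<open>s\<close> is generalised.\<close>
    have down: "?f s > 0" if "s \<ge> 0" "?f (s / 2 ^ m) > 0" for s m
      using that
    proof (induction m arbitrary: s)
      case (Suc m)
      have "?f (s / 2) > 0"
        using Suc.IH[of "s / 2"] Suc.prems by (simp only: power_Suc divide_divide_eq_left)
      then have "?f (2 * (s / 2)) > 0" using Suc.prems(1) by (intro double) simp_all
      moreover have "2 * (s / 2) = s" by simp
      ultimately show ?case by metis
    qed (simp only: power_0 div_by_1)
    have "(\<lambda>m. t / 2 ^ m) \<longlonglongrightarrow> 0"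
      using LIMSEQ_divide_realpow_zero[of 2 t] by simp
    then have "(\<lambda>m. ?f (t / 2 ^ m)) \<longlonglongrightarrow> 1"
      by (rule filterlim_compose[OF tendsto_minor_mat_exp[OF assms(1) set\<alpha>]])
    \<comment> \<open>The limit 1 is positive, so the minors along the sequence are eventually
      positive, and a single such \<open>m\<close> starts the doubling.\<close>
    then have "\<forall>\<^sub>F m in sequentially. ?f (t / 2 ^ m) > 0"
      by (rule order_tendstoD) simp
    then obtain m where "?f (t / 2 ^ m) > 0"
      by (auto simp: eventually_sequentially)
    then show "?f t > 0" using down[OF t] by blast
  qed
  then show ?thesis
    using assms(1) by (auto simp: EP_matrix_def P_matrix_def)
qed

end
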